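(* For every finite set of formulas $\Gamma$ and every formula $A$: $\Gamma \models A \Longleftrightarrow \Gamma \models^{\alpha} A$, where $\models$ is logical consequence in non-monotonic standard base semantics and $\models^{\alpha}$ is logical consequence in non-monotonic reducibility semantics.
   Context: **Language.** Formulas: $X ::= p, q, r, s, t, \ldots \mid \bot \mid X \wedge X \mid X \vee X \mid X \rightarrow X$, with $\neg X := X \rightarrow \bot$. Atomic formulas (atoms) are the propositional variables and $\bot$ (an atomic constant for absurdity). $\Gamma$ always denotes a finite set of formulas. **Atomic bases.** Every atom is an atomic rule of level $0$. Given atoms $A_1,\ldots,A_n$ and (possibly empty) finite sets of atomic rules $\mathfrak{C}_1,\ldots,\mathfrak{C}_n$, where the rules "from $\mathfrak{C}_i$ infer $A_i$" have maximal level $k-1$ (if $\mathfrak{C}_i=\emptyset$, this is just the atom $A_i$, of level $0$), and given an atom $A$, the rule with premises $A_1,\ldots,A_n$, conclusion $A$, and discharging $\mathfrak{C}_i$ above the $i$-th premise, is an atomic rule of level $k$. An atomic base of level $k$ is a set of atomic rules of maximal level $k$; there is no upper bound on the admitted levels $k$. Derivations are the usual natural deduction trees: an atom $A$ is derivable from a set of rules $\mathfrak{S}$ when some rule in $\mathfrak{S}$ has conclusion $A$ and each premise $A_i$ of it is derivable from $\mathfrak{S} \cup \mathfrak{C}_i$, $\mathfrak{C}_i$ being the set of rules discharged at that premise (an atom in $\mathfrak{S}$ is derivable outright). $\mathrm{DER}_{\mathfrak{B}}$ is the set of derivations over $\mathfrak{B}$, and $\vdash_{\mathfrak{B}} A$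 means that $A$ is derivable from $\mathfrak{B}$. All atomic bases $\mathfrak{B}$ are assumed consistent: $\not\vdash_{\mathfrak{B}} \bot$. **Standard base semantics.** $\Gamma \models_{\mathfrak{B}} A$ is defined by: if $\Gamma = \emptyset$, then for $A$ atomic, $\models_{\mathfrak{B}} A$ iff $\vdash_{\mathfrak{B}} A$; $\models_{\mathfrak{B}} B \wedge C$ iff $\models_{\mathfrak{B}} B$ and $\models_{\mathfrak{B}} C$; $\models_{\mathfrak{B}} B \vee C$ iff $\models_{\mathfrak{B}} B$ or $\models_{\mathfrak{B}} C$; $\models_{\mathfrak{B}} B \rightarrow C$ iff $B \models_{\mathfrak{B}} C$. If $\Gamma \neq \emptyset$, then $\Gamma \models_{\mathfrak{B}} A$ iff ($\models_{\mathfrak{B}} B$ for all $B \in \Gamma$ implies $\models_{\mathfrak{B}} A$). Logical consequence: $\Gamma \models A$ iff $\Gamma \models_{\mathfrak{B}} A$ for every atomic base $\mathfrak{B}$. **Reducibility semantics.** An *argument structure* is a pair $\mathscr{D} = \langle T, f\rangle$ where $T$ is a finite rooted tree with order relation $\omega$, with nodes labelled by formulas and top-nodes partitioned into axiomatic and non-axiomatic ones; $f$ is a discharge function, mapping onto lower nodes elements of (a) a subset of the non-axiomatic top-nodes, (b) a subset of the axiomatic top-nodes labelled by atoms, (c) a subset of $\wp(\omega)$, each element of which contains only the pairs linking a node labelled by an atom to all its children, labelled by atoms too, with no non-axiomatic top-node mapped by $f$ onto such a maximal node or onto the image of the latter under $f$ (so $f$ indicates where assumptions, atomic axioms and atomic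 rules are discharged). The non-axiomatic top-nodes are the assumptions, the root is the conclusion. $\mathscr{D}$ is *closed* if the domain of $f$ contains all non-axiomatic top-nodes, otherwise *open*; it is *from* $\Gamma$ *to* (or *for* ) $A$ when $\Gamma$ is its set of undischarged assumptions and $A$ its conclusion. (Immediate) sub-structures, and the replacement $\mathscr{D}[\mathscr{D}^{**}/\mathscr{D}^{*}]$ of a sub-structure $\mathscr{D}^{*}$ by $\mathscr{D}^{**}$, are defined as usual. If $\mathscr{D}$ is from $\{A_1,\ldots,A_n\}$ to $A$ and $\sigma$ maps formulas to argument structures so that $\sigma(A_i)$ is a (closed) argument structure for $A_i$, then $\mathscr{D}^{\sigma} = \mathscr{D}[\sigma(A_1),\ldots,\sigma(A_n)/A_1,\ldots,A_n]$ is a (closed) *instance* of $\mathscr{D}$. An *inference* is a triple $\langle\langle \mathscr{D}_1,\ldots,\mathscr{D}_n\rangle, A, \delta\rangle$ ($n \ge 0$) with $\delta$ an extension of the discharge functions of the $\mathscr{D}_i$; its associated argument structure joins the trees of the $\mathscr{D}_i$ by a new root $A$, with discharges as given by $\delta$. An *inference rule* is a set of inferences. $\mathscr{D}$ is *canonical* iff it is associated to an instance of one of Gentzen's introduction rules for $\wedge,\vee,\rightarrow$. A *reduction* for a rule $R$ is a function $\phi$ from and to argument structures, defined on some subset $\mathbb{D}$ of $R$, such that for every $\mathscr{D}$ associated to an element of $\mathbb{D}$ and every $\sigma$: (1) the instance of $R$ to which $\mathscr{D}^{\sigma}$ is associated is in $\mathbb{D}$; (2) $\phi$ is defined on $\mathscr{D}^{\sigma}$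 and $\phi(\mathscr{D}^{\sigma}) = \phi(\mathscr{D})^{\sigma}$; (3) if $\mathscr{D}$ is from $\Gamma$ to $A$, then $\phi(\mathscr{D})$ is from some $\Gamma^{*} \subseteq \Gamma$ to $A$. No constructivity or schematicity restriction is put on reductions. $\mathfrak{J}$ denotes a set of reductions; an extension of it is any set of reductions $\mathfrak{J}^{+} \supseteq \mathfrak{J}$. $\mathscr{D}$ *immediately reduces* to $\mathscr{D}^{*}$ via $\mathfrak{J}$ iff for some sub-structure $\mathscr{D}^{**}$ of $\mathscr{D}$ and some $\phi \in \mathfrak{J}$, $\mathscr{D}^{*} = \mathscr{D}[\phi(\mathscr{D}^{**})/\mathscr{D}^{**}]$; $\leq_{\mathfrak{J}}$ is the reflexive-transitive closure of this relation. An *argument* is a pair $\langle \mathscr{D}, \mathfrak{J}\rangle$, closed or open as $\mathscr{D}$ is. *Validity on* $\mathfrak{B}$ of $\langle \mathscr{D}, \mathfrak{J}\rangle$: if $\mathscr{D}$ is closed with atomic conclusion, it is valid iff $\mathscr{D} \leq_{\mathfrak{J}} \mathscr{D}^{*}$ for some $\mathscr{D}^{*} = \langle T,f\rangle$ with $T \in \mathrm{DER}_{\mathfrak{B}}$; if $\mathscr{D}$ is closed with non-atomic conclusion, it is valid iff $\mathscr{D} \leq_{\mathfrak{J}} \mathscr{D}^{*}$ for some canonical $\mathscr{D}^{*}$ whose immediate sub-structures are valid on $\mathfrak{B}$ when paired with $\mathfrak{J}$; if $\mathscr{D}$ is open with undischarged assumptions $A_1,\ldots,A_n$, it is valid iff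 for every $\sigma$ and every extension $\mathfrak{J}^{+}$ of $\mathfrak{J}$, if each $\langle \sigma(A_i), \mathfrak{J}^{+}\rangle$ ($i \le n$) is closed and valid on $\mathfrak{B}$, then $\langle \mathscr{D}^{\sigma}, \mathfrak{J}^{+}\rangle$ is valid on $\mathfrak{B}$. $\langle \mathscr{D}, \mathfrak{J}\rangle$ is *valid* iff it is valid on every $\mathfrak{B}$. $\Gamma \models^{\alpha} A$ iff there is a valid argument $\langle \mathscr{D}, \mathfrak{J}\rangle$ from $\Gamma$ to $A$ (one and the same argument for all bases). *)

theory Defs
  imports Main "HOL-Library.FSet" "HOL-Library.Sublist"
begin

section \<open>Formulas\<close>

datatype atom = PVar nat | Bot

datatype fm = Atom atom | And fm fm | Or fm fm | Imp fm fm

definition Neg :: "fm \<Rightarrow> fm" where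
  "Neg A = Imp A (Atom Bot)"

definition atomic :: "fm \<Rightarrow> bool" where
  "atomic A \<longleftrightarrow> (\<exists>a. A = Atom a)"


section \<open>Atomic rules, derivations and bases\<close>

text \<open>\<open>Rule [(C\<^sub>1, A\<^sub>1), \<dots>, (C\<^sub>n, A\<^sub>n)] A\<close> has premises \<open>A\<^sub>i\<close>, conclusion \<open>A\<close>, and discharges the
  rules \<open>C\<^sub>i\<close> above its \<open>i\<close>-th premise. The atom \<open>A\<close>, regarded as a rule, is \<open>Rule [] A\<close>.\<close>

datatype arule = Rule "(arule fset \<times> atom) list" atom

text \<open>The level of ``from \<open>C\<close> infer \<open>P\<close>'', given the set of the levels of the rules in \<open>C\<close>.\<close>

definition infer_level :: "nat fset \<Rightarrow> nat" where
  "infer_level N = (if N = {||} then 0 else Suc (Max (fset N)))"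

primrec level :: "arule \<Rightarrow> nat" where
  "level (Rule ps A) =
    (if ps = [] then 0
     else Suc (Max (set (map (infer_level \<circ> fst) (map (map_prod (fimage level) id) ps)))))"

text \<open>Trees labelled by formulas. \<open>Asm A\<close> is a non-axiomatic top-node (an assumption); an axiomatic
  top-node labelled by \<open>A\<close> is the conclusion \<open>Inf A []\<close> of an inference without premises.\<close>

datatype tree = Asm fm | Inf fm "tree list"

fun label :: "tree \<Rightarrow> fm" where
  "label (Asm A) = A"
| "label (Inf A Ts) = A"

fun children :: "tree \<Rightarrow> tree list" where
  "children (Asm A) = []"
| "children (Inf A Ts) = Ts"

inductive deriv :: "arule set \<Rightarrow> tree \<Rightarrow> bool" where
  "\<lbrakk>Rule ps A \<in> S;
    list_all2 (\<lambda>p T. label T = Atom (snd p) \<and> deriv (S \<union> fset (fst p)) T) ps Ts\<rbrakk>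
   \<Longrightarrow> deriv S (Inf (Atom A) Ts)"

definition DER :: "arule set \<Rightarrow> tree set" where
  "DER B = {T. deriv B T}"

definition derivable :: "arule set \<Rightarrow> atom \<Rightarrow> bool" where
  "derivable B a \<longleftrightarrow> (\<exists>T \<in> DER B. label T = Atom a)"

text \<open>A base has some finite level (without any bound on it) and is consistent.\<close>

definition atomic_base :: "arule set \<Rightarrow> bool" where
  "atomic_base B \<longleftrightarrow> (\<exists>k. \<forall>r \<in> B. level r \<le> k) \<and> \<not> derivable B Bot"


section \<open>Standard base semantics\<close>

primrec sat :: "arule set \<Rightarrow> fm \<Rightarrow> bool" where
  "sat B (Atom a) \<longleftrightarrow> derivable B a"
| "sat B (And A C) \<longleftrightarrow> sat B A \<and> sat B C"
| "sat B (Or A C) \<longleftrightarrow> sat B A \<or> sat B C"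
| "sat B (Imp A C) \<longleftrightarrow> (sat B A \<longrightarrow> sat B C)"

definition base_conseq_on :: "arule set \<Rightarrow> fm set \<Rightarrow> fm \<Rightarrow> bool" where
  "base_conseq_on B \<Gamma> A \<longleftrightarrow>
    (if \<Gamma> = {} then sat B A else (\<forall>C \<in> \<Gamma>. sat B C) \<longrightarrow> sat B A)"

definition base_conseq :: "fm set \<Rightarrow> fm \<Rightarrow> bool"  (infix "\<Turnstile>" 50) where
  "\<Gamma> \<Turnstile> A \<longleftrightarrow> (\<forall>B. atomic_base B \<longrightarrow> base_conseq_on B \<Gamma> A)"


section \<open>Argument structures\<close>

text \<open>A node is addressed by the path leading to it from the root; so \<open>q\<close> lies below \<open>p\<close>
  (closer to the root) iff \<open>q\<close> is a proper prefix of \<open>p\<close>.\<close>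

type_synonym pos = "nat list"

fun sub_at :: "tree \<Rightarrow> pos \<Rightarrow> tree option" where
  "sub_at T [] = Some T"
| "sub_at T (i # p) = (if i < length (children T) then sub_at (children T ! i) p else None)"

definition nodes :: "tree \<Rightarrow> pos set" where
  "nodes T = dom (sub_at T)"

text \<open>In \<open>(T, f)\<close>, \<open>f p = Some q\<close> for a top-node \<open>p\<close> means that this assumption or axiom is
  discharged at \<open>q\<close>. For an inner node \<open>p\<close>, the argument \<open>p\<close> of \<open>f\<close> stands for the set of edges
  linking \<open>p\<close> to all its children: the atomic rule applied at \<open>p\<close> is discharged at \<open>q\<close>.\<close>

type_synonym argstr = "tree \<times> (pos \<rightharpoonup> pos)"

definition is_asm :: "tree \<Rightarrow> pos \<Rightarrow> bool" where
  "is_asm T p \<longleftrightarrow> (\<exists>A. sub_at T p = Some (Asm A))"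

definition arg_structure :: "argstr \<Rightarrow> bool" where
  "arg_structure D \<longleftrightarrow> (case D of (T, f) \<Rightarrow>
    \<forall>p q. f p = Some q \<longrightarrow>
      strict_prefix q p \<and>
      (\<exists>S. sub_at T p = Some S \<and>
        (case S of
          Asm A \<Rightarrow> True
        | Inf A Ts \<Rightarrow>
            atomic A \<and> (\<forall>t \<in> set Ts. atomic (label t)) \<and>
            (Ts \<noteq> [] \<longrightarrow> (\<forall>l. is_asm T l \<longrightarrow> f l \<noteq> Some p \<and> f l \<noteq> Some q)))))"

definition concl :: "argstr \<Rightarrow> fm" where
  "concl D = label (fst D)"

definition open_asm :: "argstr \<Rightarrow> pos \<Rightarrow> bool" where
  "open_asm D p \<longleftrightarrow> is_asm (fst D) p \<and> p \<notin> dom (snd D)"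

definition closed_str :: "argstr \<Rightarrow> bool" where
  "closed_str D \<longleftrightarrow> (\<forall>p. is_asm (fst D) p \<longrightarrow> p \<in> dom (snd D))"

definition label_at :: "tree \<Rightarrow> pos \<Rightarrow> fm" where
  "label_at T p = label (the (sub_at T p))"

definition asms :: "argstr \<Rightarrow> fm set" where
  "asms D = {label_at (fst D) p | p. open_asm D p}"

text \<open>The sub-structure at \<open>p\<close> forgets the discharges at nodes below \<open>p\<close>.\<close>

definition sub_structure :: "argstr \<Rightarrow> pos \<Rightarrow> argstr" where
  "sub_structure D p = (case D of (T, f) \<Rightarrow>
    (the (sub_at T p),
     \<lambda>r. case f (p @ r) of
           None \<Rightarrow> None
         | Some q \<Rightarrow> if prefix p q then Some (drop (length p) q) else None))"

definition immediate_subs :: "argstr \<Rightarrow> argstr set" where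
  "immediate_subs D = {sub_structure D [i] | i. [i] \<in> nodes (fst D)}"

lemma size_nth_child [termination_simp]: "i < length Ts \<Longrightarrow> size (Ts ! i) < Suc (size_list size Ts)"
  by (metis less_Suc_eq_le nth_mem order_refl size_list_estimation')

text \<open>\<open>graft h T\<close> replaces the subtree of \<open>T\<close> at \<open>p\<close> by \<open>S\<close> wherever \<open>h p = Some S\<close>.\<close>

fun graft :: "(pos \<rightharpoonup> tree) \<Rightarrow> tree \<Rightarrow> tree" where
  "graft h (Asm A) = (case h [] of Some S \<Rightarrow> S | None \<Rightarrow> Asm A)"
| "graft h (Inf A Ts) =
    (case h [] of
      Some S \<Rightarrow> S
    | None \<Rightarrow> Inf A (map (\<lambda>i. graft (\<lambda>p. h (i # p)) (Ts ! i)) [0..<length Ts]))"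

text \<open>What is dischargeable at a node: an assumption, an axiom, or an application of a rule.\<close>

definition item :: "tree \<Rightarrow> bool \<times> fm \<times> fm list" where
  "item T = ((\<exists>A. T = Asm A), label T, map label (children T))"

text \<open>\<open>replaces D p E D'\<close>: \<open>D'\<close> results from \<open>D\<close> by replacing its sub-structure at \<open>p\<close> by \<open>E\<close>.
  Discharges within \<open>E\<close> and outside of \<open>p\<close> are kept. Something undischarged in \<open>E\<close> is treated
  (discharged at a node below \<open>p\<close>, or not discharged) like an equal item that is undischarged in the
  replaced sub-structure, if there is one, and remains undischarged otherwise. Equal items of the
  replaced sub-structure may be treated differently in \<open>D\<close>; any of them may then be followed, and so
  this is a relation rather than a function.\<close>

definition inherited :: "argstr \<Rightarrow> pos \<Rightarrow> tree \<Rightarrow> pos option set" where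
  "inherited D p S = {snd D (p @ r) | r S'.
    sub_at (fst (sub_structure D p)) r = Some S' \<and> item S' = item S \<and>
    snd (sub_structure D p) r = None}"

definition replaces :: "argstr \<Rightarrow> pos \<Rightarrow> argstr \<Rightarrow> argstr \<Rightarrow> bool" where
  "replaces D p E D' \<longleftrightarrow>
    fst D' = graft [p \<mapsto> fst E] (fst D) \<and>
    (\<forall>q. \<not> prefix p q \<longrightarrow> snd D' q = snd D q) \<and>
    (\<forall>r. case snd E r of
           Some s \<Rightarrow> snd D' (p @ r) = Some (p @ s)
         | None \<Rightarrow>
            (case sub_at (fst E) r of
               None \<Rightarrow> snd D' (p @ r) = None
             | Some S \<Rightarrow>
                 if inherited D p S = {} then snd D' (p @ r) = None
                 else snd D' (p @ r) \<in> inherited D p S))"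

text \<open>The instance \<open>D\<^sup>\<sigma>\<close>: every undischarged assumption \<open>A\<close> is replaced by \<open>\<sigma> A\<close>.
  The undischarged assumptions of \<open>\<sigma> A\<close> remain undischarged.\<close>

definition inst :: "(fm \<Rightarrow> argstr) \<Rightarrow> argstr \<Rightarrow> argstr" where
  "inst \<sigma> D =
    (graft (\<lambda>p. if open_asm D p then Some (fst (\<sigma> (label_at (fst D) p))) else None) (fst D),
     \<lambda>q. case find (open_asm D) (prefixes q) of
           None \<Rightarrow> snd D q
         | Some p \<Rightarrow>
             map_option ((@) p) (snd (\<sigma> (label_at (fst D) p)) (drop (length p) q)))"

definition substitution_for :: "(fm \<Rightarrow> argstr) \<Rightarrow> argstr \<Rightarrow> bool" where
  "substitution_for \<sigma> D \<longleftrightarrow> (\<forall>A \<in> asms D. arg_structure (\<sigma> A) \<and> concl (\<sigma> A) = A)"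

definition closed_substitution_for :: "(fm \<Rightarrow> argstr) \<Rightarrow> argstr \<Rightarrow> bool" where
  "closed_substitution_for \<sigma> D \<longleftrightarrow>
    substitution_for \<sigma> D \<and> (\<forall>A \<in> asms D. closed_str (\<sigma> A))"


section \<open>Inferences and canonical structures\<close>

type_synonym inference = "argstr list \<times> fm \<times> (pos \<rightharpoonup> pos)"

definition assoc_str :: "inference \<Rightarrow> argstr" where
  "assoc_str I = (case I of (Ds, A, \<delta>) \<Rightarrow> (Inf A (map fst Ds), \<delta>))"

text \<open>The last condition says that \<open>\<delta>\<close> extends the discharge functions of the \<open>Ds\<close>, and that
  everything newly discharged is discharged at the new root.\<close>

definition inferences :: "inference set" where
  "inferences = {(Ds, A, \<delta>).
    (\<forall>D \<in> set Ds. arg_structure D) \<and> arg_structure (assoc_str (Ds, A, \<delta>)) \<and>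
    (\<forall>i < length Ds. sub_structure (assoc_str (Ds, A, \<delta>)) [i] = Ds ! i)}"

definition inference_rule :: "inference set \<Rightarrow> bool" where
  "inference_rule R \<longleftrightarrow> R \<subseteq> inferences"

definition conj_intro :: "inference set" where
  "conj_intro = {(Ds, C, \<delta>) \<in> inferences. \<exists>A B. C = And A B \<and>
    map concl Ds = [A, B] \<and> (\<forall>p. \<delta> p \<noteq> Some [])}"

definition disj_intro :: "inference set" where
  "disj_intro = {(Ds, C, \<delta>) \<in> inferences. \<exists>A B. C = Or A B \<and>
    (map concl Ds = [A] \<or> map concl Ds = [B]) \<and> (\<forall>p. \<delta> p \<noteq> Some [])}"

definition imp_intro :: "inference set" where
  "imp_intro = {(Ds, C, \<delta>) \<in> inferences. \<exists>A B. C = Imp A B \<and>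
    map concl Ds = [B] \<and>
    (\<forall>p. \<delta> p = Some [] \<longrightarrow> sub_at (fst (assoc_str (Ds, C, \<delta>))) p = Some (Asm A))}"

definition canonical :: "argstr \<Rightarrow> bool" where
  "canonical D \<longleftrightarrow> D \<in> assoc_str ` (conj_intro \<union> disj_intro \<union> imp_intro)"


section \<open>Reductions\<close>

type_synonym red = "argstr \<rightharpoonup> argstr"

definition reduction_for :: "inference set \<Rightarrow> red \<Rightarrow> bool" where
  "reduction_for R \<phi> \<longleftrightarrow>
    (\<exists>\<DD> \<subseteq> R. dom \<phi> = assoc_str ` \<DD> \<and>
      (\<forall>D E. \<phi> D = Some E \<longrightarrow>
        arg_structure E \<and>
        (\<forall>\<sigma>. substitution_for \<sigma> D \<longrightarrow>
          inst \<sigma> D \<in> assoc_str ` \<DD> \<and> \<phi> (inst \<sigma> D) = Some (inst \<sigma> E)) \<and>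
        asms E \<subseteq> asms D \<and> concl E = concl D))"

definition reduction :: "red \<Rightarrow> bool" where
  "reduction \<phi> \<longleftrightarrow> (\<exists>R. inference_rule R \<and> reduction_for R \<phi>)"

definition reduces1 :: "red set \<Rightarrow> argstr \<Rightarrow> argstr \<Rightarrow> bool" where
  "reduces1 J D D' \<longleftrightarrow>
    (\<exists>p \<in> nodes (fst D). \<exists>\<phi> \<in> J. \<exists>E.
      \<phi> (sub_structure D p) = Some E \<and> replaces D p E D')"

definition reduces :: "red set \<Rightarrow> argstr \<Rightarrow> argstr \<Rightarrow> bool" where
  "reduces J = (reduces1 J)\<^sup>*\<^sup>*"

definition argument :: "argstr \<Rightarrow> red set \<Rightarrow> bool" where
  "argument D J \<longleftrightarrow> arg_structure D \<and> (\<forall>\<phi> \<in> J. reduction \<phi>)"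


section \<open>Reduction and instantiation preserve conclusions and assumptions\<close>

lemma closed_str_iff: "closed_str D \<longleftrightarrow> asms D = {}"
  by (auto simp: closed_str_def asms_def open_asm_def)

lemma sub_at_append: "sub_at T (p @ q) = Option.bind (sub_at T p) (\<lambda>S. sub_at S q)"
  by (induction p arbitrary: T) auto

lemma finite_nodes: "finite (nodes T)"
proof (induction T)
  case (Asm A)
  have "nodes (Asm A) \<subseteq> {[]}"
    by (auto simp: nodes_def elim: sub_at.elims)
  then show ?case by (rule finite_subset) simp
next
  case (Inf A Ts)
  have "nodes (Inf A Ts) \<subseteq> insert [] (\<Union>i<length Ts. (#) i ` nodes (Ts ! i))"
  proof
    fix p assume "p \<in> nodes (Inf A Ts)"
    then show "p \<in> insert [] (\<Union>i<length Ts. (#) i ` nodes (Ts ! i))"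
      by (cases p) (auto simp: nodes_def image_iff split: if_splits)
  qed
  then show ?case by (rule finite_subset) (use Inf in auto)
qed

lemma is_asm_nodes: "is_asm T p \<Longrightarrow> p \<in> nodes T"
  by (auto simp: is_asm_def nodes_def)

lemma finite_asms: "finite (asms D)"
proof -
  have "asms D \<subseteq> label_at (fst D) ` nodes (fst D)"
    by (auto simp: asms_def open_asm_def intro: is_asm_nodes)
  then show ?thesis by (rule finite_subset) (simp add: finite_nodes)
qed

lemma sub_at_graft:
  assumes "\<And>r. strict_prefix r p \<Longrightarrow> h r = None"
  shows "sub_at (graft h T) p = map_option (graft (\<lambda>r. h (p @ r))) (sub_at T p)"
  using assms
proof (induction p arbitrary: h T)
  case (Cons i p)
  have h: "h [] = None" using Cons.prems by simp
  have "sub_at (graft (\<lambda>r. h (i # r)) S) p = map_option (graft (\<lambda>r. h (i # p @ r))) (sub_at S p)" for S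
    using Cons.IH[of "\<lambda>r. h (i # r)" S] Cons.prems by simp
  then show ?case using h by (cases T) auto
qed simp

lemma graft_root: "h [] = Some S \<Longrightarrow> graft h T = S"
  by (cases T) auto

lemma label_graft: "h [] = None \<Longrightarrow> label (graft h T) = label T"
  by (cases T) auto

lemma graft_eq_Asm: "h [] = None \<Longrightarrow> graft h T = Asm A \<longleftrightarrow> T = Asm A"
  by (cases T) auto

lemma sub_at_graft_inside:
  assumes "p \<in> nodes T" "h p = Some S" "\<And>r. strict_prefix r p \<Longrightarrow> h r = None"
  shows "sub_at (graft h T) (p @ r) = sub_at S r"
proof -
  obtain U where "sub_at T p = Some U" using assms(1) by (auto simp: nodes_def)
  then have "sub_at (graft h T) p = Some S"
    using sub_at_graft[of p h T] assms graft_root[of "\<lambda>r. h (p @ r)" S U] by simp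
  then show ?thesis by (simp add: sub_at_append)
qed

lemma sub_at_graft_outside:
  assumes "\<And>r. prefix r q \<Longrightarrow> h r = None"
  shows "sub_at (graft h T) q = Some (Asm A) \<longleftrightarrow> sub_at T q = Some (Asm A)"
proof -
  have "sub_at (graft h T) q = map_option (graft (\<lambda>r. h (q @ r))) (sub_at T q)"
    using assms by (intro sub_at_graft) auto
  moreover have "h q = None" using assms by simp
  ultimately show ?thesis using graft_eq_Asm[of "\<lambda>r. h (q @ r)"] by auto
qed

lemma open_asm_iff:
  "open_asm D p \<longleftrightarrow> sub_at (fst D) p = Some (Asm (label_at (fst D) p)) \<and> snd D p = None"
  by (auto simp: open_asm_def is_asm_def label_at_def)

lemma asms_iff: "A \<in> asms D \<longleftrightarrow> (\<exists>p. sub_at (fst D) p = Some (Asm A) \<and> snd D p = None)"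
  by (auto simp: asms_def open_asm_def is_asm_def label_at_def) force

lemma snd_sub_structure_None:
  "snd (sub_structure D p) r = None \<longleftrightarrow> (\<forall>q. snd D (p @ r) = Some q \<longrightarrow> \<not> prefix p q)"
  by (auto simp: sub_structure_def split: prod.splits option.splits)

lemma fst_sub_structure [simp]: "fst (sub_structure D p) = the (sub_at (fst D) p)"
  by (auto simp: sub_structure_def split: prod.splits)

lemma asms_replaces:
  assumes p: "p \<in> nodes (fst D)" and rep: "replaces D p E D'"
    and sub: "asms E \<subseteq> asms (sub_structure D p)"
  shows "asms D' \<subseteq> asms D"
proof
  fix A assume "A \<in> asms D'"
  then obtain q where q: "sub_at (fst D') q = Some (Asm A)" "snd D' q = None"
    by (auto simp: asms_iff)
  have tree: "fst D' = graft [p \<mapsto> fst E] (fst D)" using rep by (simp add: replaces_def)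
  show "A \<in> asms D"
  proof (cases "prefix p q")
    case False
    then have "sub_at (fst D) q = Some (Asm A)"
      using q sub_at_graft_outside[of q "[p \<mapsto> fst E]" "fst D" A] tree by auto
    moreover have "snd D q = None" using rep q False by (simp add: replaces_def)
    ultimately show ?thesis by (auto simp: asms_iff)
  next
    case True
    then obtain r where r: "q = p @ r" by (auto simp: prefix_def)
    have at: "sub_at (fst E) r = Some (Asm A)"
      using q(1) sub_at_graft_inside[of p "fst D" "[p \<mapsto> fst E]" "fst E" r] p tree r by auto
    have *: "case snd E r of
           Some s \<Rightarrow> snd D' (p @ r) = Some (p @ s)
         | None \<Rightarrow>
            (case sub_at (fst E) r of
               None \<Rightarrow> snd D' (p @ r) = None
             | Some S \<Rightarrow>
                 if inherited D p S = {} then snd D' (p @ r) = None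
                 else snd D' (p @ r) \<in> inherited D p S)"
      using rep by (simp add: replaces_def)
    have none: "snd E r = None" using * q(2) r by (auto split: option.splits)
    have mem: "inherited D p (Asm A) = {} \<or> None \<in> inherited D p (Asm A)"
      using * none at q(2) r by (auto split: if_splits)
    have "A \<in> asms E" using at none by (auto simp: asms_iff)
    with sub have "A \<in> asms (sub_structure D p)" by blast
    then have "inherited D p (Asm A) \<noteq> {}"
      by (fastforce simp: asms_iff inherited_def)
    with mem have "None \<in> inherited D p (Asm A)" by simp
    then obtain r' S' where r': "snd D (p @ r') = None"
      "sub_at (the (sub_at (fst D) p)) r' = Some S'" "item S' = item (Asm A)"
      by (auto simp: inherited_def eq_commute[of None])
    have "S' = Asm A" using r'(3) by (cases S') (auto simp: item_def)
    then have "sub_at (fst D) (p @ r') = Some (Asm A)"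
      using r'(2) p by (auto simp: sub_at_append nodes_def)
    then show ?thesis using r'(1) by (auto simp: asms_iff)
  qed
qed

lemma concl_replaces:
  assumes p: "p \<in> nodes (fst D)" and rep: "replaces D p E D'"
    and sub: "concl E = concl (sub_structure D p)"
  shows "concl D' = concl D"
proof (cases "p = []")
  case True
  then show ?thesis using rep sub
    by (simp add: replaces_def concl_def graft_root)
next
  case False
  then show ?thesis using rep
    by (simp add: replaces_def concl_def label_graft)
qed

lemma reduction_props:
  assumes "reduction \<phi>" "\<phi> D = Some E"
  shows "asms E \<subseteq> asms D" "concl E = concl D"
  using assms unfolding reduction_def reduction_for_def by blast+

lemma reduces_props:
  assumes "\<And>\<phi>. \<phi> \<in> J \<Longrightarrow> reduction \<phi>" "reduces J D D'"
  shows "asms D' \<subseteq> asms D \<and> concl D' = concl D"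
  using assms(2) unfolding reduces_def
proof (induction rule: rtranclp_induct)
  case (step D' D'')
  from step.hyps(2) obtain p \<phi> E where
    p: "p \<in> nodes (fst D')" "\<phi> \<in> J" "\<phi> (sub_structure D' p) = Some E" "replaces D' p E D''"
    unfolding reduces1_def by blast
  have "asms D'' \<subseteq> asms D'"
    using asms_replaces[OF p(1,4)] reduction_props(1)[OF assms(1)[OF p(2)] p(3)] by blast
  moreover have "concl D'' = concl D'"
    using concl_replaces[OF p(1,4)] reduction_props(2)[OF assms(1)[OF p(2)] p(3)] by blast
  ultimately show ?case using step.IH by auto
qed simp

lemma no_node_above_asm:
  assumes "is_asm T p" "strict_prefix p q"
  shows "q \<notin> nodes T"
proof -
  obtain i r where "q = p @ i # r" using assms(2) by (auto elim: strict_prefixE')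
  then show ?thesis using assms(1) by (auto simp: is_asm_def nodes_def sub_at_append)
qed

lemma inst_props:
  assumes \<sigma>: "closed_substitution_for \<sigma> D"
  shows "closed_str (inst \<sigma> D)" "concl (inst \<sigma> D) = concl D"
proof -
  define h where "h = (\<lambda>p. if open_asm D p then Some (fst (\<sigma> (label_at (fst D) p))) else None)"
  have tree: "fst (inst \<sigma> D) = graft h (fst D)" by (simp add: inst_def h_def)
  have dis: "snd (inst \<sigma> D) q = (case find (open_asm D) (prefixes q) of
           None \<Rightarrow> snd D q
         | Some p \<Rightarrow>
             map_option ((@) p) (snd (\<sigma> (label_at (fst D) p)) (drop (length p) q)))" for q
    by (simp add: inst_def)
  show "closed_str (inst \<sigma> D)"
    unfolding closed_str_def
  proof (intro allI impI)
    fix q assume "is_asm (fst (inst \<sigma> D)) q"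
    then obtain A where A: "sub_at (graft h (fst D)) q = Some (Asm A)"
      by (auto simp: is_asm_def tree)
    show "q \<in> dom (snd (inst \<sigma> D))"
    proof (cases "find (open_asm D) (prefixes q)")
      case None
      then have no: "\<And>r. prefix r q \<Longrightarrow> \<not> open_asm D r" by (auto simp: find_None_iff)
      then have "sub_at (fst D) q = Some (Asm A)"
        using A sub_at_graft_outside[of q h "fst D" A] by (auto simp: h_def)
      then have "snd D q \<noteq> None" using no[of q] by (auto simp: open_asm_def is_asm_def)
      then show ?thesis using dis[of q] None by auto
    next
      case (Some p)
      then have op: "open_asm D p" and pre: "prefix p q"
        by (auto simp: find_Some_iff in_set_prefixes[symmetric] simp del: in_set_prefixes)
      obtain r where r: "q = p @ r" using pre by (auto simp: prefix_def)
      have pn: "p \<in> nodes (fst D)" using op by (auto simp: open_asm_def intro: is_asm_nodes)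
      have "h s = None" if "strict_prefix s p" for s
        using no_node_above_asm[of "fst D" s p] that pn by (auto simp: h_def open_asm_def)
      then have "sub_at (fst (\<sigma> (label_at (fst D) p))) r = Some (Asm A)"
        using A sub_at_graft_inside[OF pn, of h] op r by (auto simp: h_def)
      moreover have "label_at (fst D) p \<in> asms D" using op by (auto simp: asms_def)
      ultimately have "snd (\<sigma> (label_at (fst D) p)) r \<noteq> None"
        using \<sigma> by (auto simp: closed_substitution_for_def closed_str_def is_asm_def)
      then show ?thesis using dis[of q] Some r by auto
    qed
  qed
  show "concl (inst \<sigma> D) = concl D"
  proof (cases "open_asm D []")
    case True
    then have "label_at (fst D) [] \<in> asms D" by (auto simp: asms_def)
    moreover have "h [] = Some (fst (\<sigma> (label_at (fst D) [])))" using True by (simp add: h_def)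
    ultimately show ?thesis using \<sigma>
      by (simp add: concl_def tree graft_root label_at_def closed_substitution_for_def substitution_for_def)
  next
    case False
    then show ?thesis by (simp add: concl_def tree label_graft h_def)
  qed
qed

lemma canonical_immediate_subs:
  assumes can: "canonical D" and cl: "closed_str D" and E: "E \<in> immediate_subs D"
    and A: "A \<in> insert (concl E) (asms E)"
  shows "size A < size (concl D)"
proof -
  obtain i where i: "[i] \<in> nodes (fst D)" "E = sub_structure D [i]"
    using E by (auto simp: immediate_subs_def)
  obtain Ds C \<delta> where I: "(Ds, C, \<delta>) \<in> conj_intro \<union> disj_intro \<union> imp_intro"
    and D: "D = (Inf C (map fst Ds), \<delta>)"
    using can by (auto simp: canonical_def assoc_str_def split: prod.splits)
  have il: "i < length Ds" using i(1) D by (auto simp: nodes_def split: if_splits)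
  have "concl E = map concl Ds ! i" using i(2) il D by (simp add: concl_def)
  then have c: "concl E \<in> set (map concl Ds)" using il by (metis length_map nth_mem)
  have asm: "\<exists>p. \<delta> p = Some [] \<and> sub_at (fst D) p = Some (Asm A)" if AE: "A \<in> asms E"
  proof -
    obtain r where r: "sub_at (the (sub_at (fst D) [i])) r = Some (Asm A)"
      "snd (sub_structure D [i]) r = None"
      using AE unfolding i(2) asms_iff fst_sub_structure by blast
    have at: "sub_at (fst D) ([i] @ r) = Some (Asm A)"
      using r(1) i(1) unfolding sub_at_append nodes_def by (metis Option.bind.simps(2) domD option.sel)
    then obtain q where q: "\<delta> ([i] @ r) = Some q"
      using cl unfolding closed_str_def is_asm_def D by (metis domD snd_conv)
    then have npre: "\<not> prefix [i] q" using r(2) D by (auto simp: snd_sub_structure_None)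
    have "arg_structure D"
      using I D by (auto simp: conj_intro_def disj_intro_def imp_intro_def inferences_def assoc_str_def)
    then have "strict_prefix q ([i] @ r)" using q D by (auto simp: arg_structure_def)
    then have "q = []" using npre by (cases q) auto
    then show ?thesis using at q by blast
  qed
  have D': "D = assoc_str (Ds, C, \<delta>)" using D by (simp add: assoc_str_def)
  show ?thesis
    using I c asm A unfolding conj_intro_def disj_intro_def imp_intro_def
    by (auto simp: D' concl_def assoc_str_def)
qed


section \<open>Validity\<close>

text \<open>In the atomic clause only the tree is compared with the derivations over \<open>B\<close>: which rules a
  derivation applies and discharges is determined by \<open>deriv\<close>, not by the discharge function of \<open>D'\<close>.\<close>

declare conj_cong [fundef_cong]

function valid_on :: "arule set \<Rightarrow> argstr \<Rightarrow> red set \<Rightarrow> bool" where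
  "valid_on B D J \<longleftrightarrow>
    argument D J \<and>
    (if closed_str D then
       (if atomic (concl D) then \<exists>D'. reduces J D D' \<and> fst D' \<in> DER B
        else \<exists>D'. reduces J D D' \<and> canonical D' \<and> (\<forall>E \<in> immediate_subs D'. valid_on B E J))
     else
       (\<forall>\<sigma> J'. J \<subseteq> J' \<and> (\<forall>\<phi> \<in> J'. reduction \<phi>) \<and> closed_substitution_for \<sigma> D \<longrightarrow>
          (\<forall>A \<in> asms D. valid_on B (\<sigma> A) J') \<longrightarrow> valid_on B (inst \<sigma> D) J'))"
  by pat_completeness auto
termination
proof (relation "measure (\<lambda>(B, D, J).
    2 * Max (size ` insert (concl D) (asms D)) + (if closed_str D then 0 else 1))",
    goal_cases)
  case (2 B D J D' E)
  then have D': "asms D' \<subseteq> asms D" "concl D' = concl D"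
    using reduces_props[of J D D'] by (auto simp: argument_def)
  have D: "asms D = {}" using 2 by (simp add: closed_str_iff)
  then have "closed_str D'" using D' by (simp add: closed_str_iff)
  then have "Max (size ` insert (concl E) (asms E)) < size (concl D)"
    using canonical_immediate_subs[of D' E] 2 D' finite_asms[of E] by (subst Max_less_iff) auto
  then show ?case using D 2 by simp
next
  case (3 B D J \<sigma> J' A)
  then have "asms (\<sigma> A) = {}" "concl (\<sigma> A) = A"
    by (auto simp: closed_substitution_for_def substitution_for_def closed_str_iff)
  moreover have "size A \<le> Max (size ` insert (concl D) (asms D))"
    using 3 finite_asms[of D] by (intro Max_ge) auto
  ultimately show ?case using 3 by (simp add: closed_str_iff)
next
  case (4 B D J \<sigma> J')
  then have "closed_str (inst \<sigma> D)" "concl (inst \<sigma> D) = concl D"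
    using inst_props by blast+
  moreover have "size (concl D) \<le> Max (size ` insert (concl D) (asms D))"
    using finite_asms[of D] by (intro Max_ge) auto
  ultimately show ?case using 4 by (simp add: closed_str_iff)
qed simp

declare conj_cong [fundef_cong del]

definition valid :: "argstr \<Rightarrow> red set \<Rightarrow> bool" where
  "valid D J \<longleftrightarrow> (\<forall>B. atomic_base B \<longrightarrow> valid_on B D J)"

definition reducibility_conseq :: "fm set \<Rightarrow> fm \<Rightarrow> bool"  (infix "\<Turnstile>\<^sup>\<alpha>" 50) where
  "\<Gamma> \<Turnstile>\<^sup>\<alpha> A \<longleftrightarrow> (\<exists>D J. argument D J \<and> asms D = \<Gamma> \<and> concl D = A \<and> valid D J)"

end

theory Submission
  imports Defs
begin

text \<open>Satisfaction on a base treats every connective truth-functionally, and it determines which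
  formulas have closed valid arguments. By induction on \<open>A\<close>, a closed argument for \<open>A\<close> that is valid
  on \<open>B\<close> yields \<open>sat B A\<close>, and \<open>sat B A\<close> yields a closed structure for \<open>A\<close> that is valid on \<open>B\<close>
  together with every set of reductions (\<open>closed_valid_adequate\<close>). The two directions need each
  other at an implication \<open>A \<rightarrow> C\<close>: a closed proof of \<open>A\<close> is what the open argument from \<open>A\<close> to \<open>C\<close> is
  applied to, and if \<open>A\<close> fails on \<open>B\<close>, then any argument from \<open>A\<close> to \<open>C\<close> whatsoever is vacuously
  valid. The second direction holds for every set of reductions because the canonical closed proofs
  are already in normal form.

  From a valid argument to base consequence: on a base that satisfies all the assumptions, substitute
  closed proofs for them and read off that the conclusion is satisfied (\<open>sat_if_valid_on\<close>).

  From base consequence to a valid argument: the argument must be the same on all bases, although the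
  closed proofs of \<open>A\<close> vary with the base. The set of all reductions makes this possible. Since a
  closed structure is equal to each of its instances, a function defined on one closed structure
  only, with an arbitrary closed structure for the same formula as its value, is a reduction
  (\<open>reduction_singleton\<close>). Consider the single inference from \<open>\<Gamma>\<close> to \<open>A\<close>, justified by all reductions.
  Its closed instances reduce in one step to any closed structure for \<open>A\<close>. If the assumptions of an
  instance are valid on \<open>B\<close>, then \<open>B\<close> satisfies \<open>\<Gamma>\<close> and hence \<open>A\<close>, and the instance reduces to the
  closed proof of \<open>A\<close> on \<open>B\<close>. No extension of the set of all reductions is proper, and so
  the instance is valid (\<open>valid_on_single_inference\<close>).\<close>

section \<open>Inferences that discharge nothing\<close>

definition join :: "fm \<Rightarrow> argstr list \<Rightarrow> argstr" where
  "join A Ds = (Inf A (map fst Ds),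
    \<lambda>p. case p of [] \<Rightarrow> None
      | i # r \<Rightarrow> if i < length Ds then map_option ((#) i) (snd (Ds ! i) r) else None)"

lemma concl_join [simp]: "concl (join A Ds) = A"
  by (simp add: join_def concl_def)

lemma join_discharge_SomeE:
  assumes "snd (join A Ds) p = Some q"
  obtains i r s where "p = i # r" "q = i # s" "i < length Ds" "snd (Ds ! i) r = Some s"
  using assms by (auto simp: join_def split: list.splits if_splits)

lemma is_asm_join_Cons:
  "is_asm (fst (join A Ds)) (i # r) \<longleftrightarrow> i < length Ds \<and> is_asm (fst (Ds ! i)) r"
  by (auto simp: is_asm_def join_def)

lemma is_asm_join:
  "is_asm (fst (join A Ds)) p \<longleftrightarrow>
    (\<exists>i r. p = i # r \<and> i < length Ds \<and> is_asm (fst (Ds ! i)) r)"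
  by (cases p) (auto simp: is_asm_def join_def)

lemma closed_str_join:
  assumes "\<forall>D \<in> set Ds. closed_str D"
  shows "closed_str (join A Ds)"
  unfolding closed_str_def
proof (intro allI impI)
  fix p assume "is_asm (fst (join A Ds)) p"
  then obtain i r where "p = i # r" "i < length Ds" "is_asm (fst (Ds ! i)) r"
    by (auto simp: is_asm_join)
  moreover from this have "r \<in> dom (snd (Ds ! i))"
    using assms by (simp add: closed_str_def)
  ultimately show "p \<in> dom (snd (join A Ds))"
    by (auto simp: join_def)
qed

lemma sub_structure_join:
  "i < length Ds \<Longrightarrow> sub_structure (join A Ds) [i] = Ds ! i"
  by (auto simp: join_def sub_structure_def prod_eq_iff fun_eq_iff split: option.splits)

lemma immediate_subs_join: "immediate_subs (join A Ds) = set Ds"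
proof -
  have "[i] \<in> nodes (fst (join A Ds)) \<longleftrightarrow> i < length Ds" for i
    by (simp add: nodes_def join_def dom_def)
  then have "immediate_subs (join A Ds) = {sub_structure (join A Ds) [i] | i. i < length Ds}"
    by (simp add: immediate_subs_def)
  also have "\<dots> = {Ds ! i | i. i < length Ds}"
    using sub_structure_join[of _ Ds A] by (intro Collect_cong) metis
  finally show ?thesis by (simp add: set_conv_nth)
qed

lemma arg_structure_join:
  assumes "\<forall>D \<in> set Ds. arg_structure D"
  shows "arg_structure (join A Ds)"
proof -
  \<comment> \<open>A discharge in the joined structure is one of a premise, with both ends shifted by the index of
    that premise; so the discharges competing with it are all located in the same premise.\<close>
  have "strict_prefix q p \<and>
      (\<exists>S. sub_at (fst (join A Ds)) p = Some S \<and>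
        (case S of
          Asm A \<Rightarrow> True
        | Inf A' Ts \<Rightarrow>
            atomic A' \<and> (\<forall>t \<in> set Ts. atomic (label t)) \<and>
            (Ts \<noteq> [] \<longrightarrow> (\<forall>l. is_asm (fst (join A Ds)) l \<longrightarrow>
              snd (join A Ds) l \<noteq> Some p \<and> snd (join A Ds) l \<noteq> Some q))))"
    if "snd (join A Ds) p = Some q" for p q
  proof -
    obtain i r s where *: "p = i # r" "q = i # s" "i < length Ds" "snd (Ds ! i) r = Some s"
      using \<open>snd (join A Ds) p = Some q\<close> by (rule join_discharge_SomeE)
    obtain T f where Di: "Ds ! i = (T, f)" by (cases "Ds ! i")
    have "arg_structure (T, f)" using assms *(3) Di by (metis nth_mem)
    then obtain S where S: "strict_prefix s r" "sub_at T r = Some S"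
      "case S of Asm A \<Rightarrow> True
        | Inf A Ts \<Rightarrow>
            atomic A \<and> (\<forall>t \<in> set Ts. atomic (label t)) \<and>
            (Ts \<noteq> [] \<longrightarrow> (\<forall>l. is_asm T l \<longrightarrow> f l \<noteq> Some r \<and> f l \<noteq> Some s))"
      using *(4) Di unfolding arg_structure_def by auto
    have at: "sub_at (fst (join A Ds)) p = Some S"
      using S(2) * Di by (simp add: join_def)
    have inner: "\<exists>l'. is_asm T l' \<and> f l' = Some u"
      if "is_asm (fst (join A Ds)) l" "snd (join A Ds) l = Some (i # u)" for l u
      using that(2) by (rule join_discharge_SomeE) (use that(1) Di in \<open>auto simp: is_asm_join_Cons\<close>)
    show ?thesis
      using S(1,3) at inner *(1,2) by (simp split: tree.splits) blast
  qed
  then show ?thesis unfolding arg_structure_def by (simp add: case_prod_beta)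
qed

lemma join_inference:
  assumes "\<forall>D \<in> set Ds. arg_structure D"
  shows "(Ds, A, snd (join A Ds)) \<in> inferences" "assoc_str (Ds, A, snd (join A Ds)) = join A Ds"
proof -
  show *: "assoc_str (Ds, A, snd (join A Ds)) = join A Ds"
    by (simp add: assoc_str_def join_def)
  show "(Ds, A, snd (join A Ds)) \<in> inferences"
    using assms unfolding inferences_def
    by (simp add: * arg_structure_join sub_structure_join)
qed

lemma join_no_root_discharge: "snd (join A Ds) p \<noteq> Some []"
  by (auto elim: join_discharge_SomeE)

lemma canonical_join_And:
  assumes "arg_structure D" "arg_structure E"
  shows "canonical (join (And (concl D) (concl E)) [D, E])"
proof -
  let ?C = "And (concl D) (concl E)"
  have inf: "([D, E], ?C, snd (join ?C [D, E])) \<in> inferences"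
    and eq: "assoc_str ([D, E], ?C, snd (join ?C [D, E])) = join ?C [D, E]"
    using join_inference[of "[D, E]"] assms by simp_all
  from inf have "([D, E], ?C, snd (join ?C [D, E])) \<in> conj_intro"
    by (simp add: conj_intro_def join_no_root_discharge)
  then show ?thesis unfolding canonical_def by (subst eq[symmetric]) blast
qed

lemma canonical_join_Or:
  assumes "arg_structure D" "concl D = A \<or> concl D = C"
  shows "canonical (join (Or A C) [D])"
proof -
  have inf: "([D], Or A C, snd (join (Or A C) [D])) \<in> inferences"
    and eq: "assoc_str ([D], Or A C, snd (join (Or A C) [D])) = join (Or A C) [D]"
    using join_inference[of "[D]"] assms by simp_all
  from inf have "([D], Or A C, snd (join (Or A C) [D])) \<in> disj_intro"
    using assms(2) by (simp add: disj_intro_def join_no_root_discharge)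
  then show ?thesis unfolding canonical_def by (subst eq[symmetric]) blast
qed

lemma canonical_join_Imp:
  assumes "arg_structure D"
  shows "canonical (join (Imp A (concl D)) [D])"
proof -
  let ?C = "Imp A (concl D)"
  have inf: "([D], ?C, snd (join ?C [D])) \<in> inferences"
    and eq: "assoc_str ([D], ?C, snd (join ?C [D])) = join ?C [D]"
    using join_inference[of "[D]"] assms by simp_all
  from inf have "([D], ?C, snd (join ?C [D])) \<in> imp_intro"
    by (simp add: imp_intro_def join_no_root_discharge)
  then show ?thesis unfolding canonical_def by (subst eq[symmetric]) blast
qed

section \<open>Reductions between closed structures\<close>

lemma graft_empty: "graft (\<lambda>p. None) T = T"
  by (induction T) (auto intro: nth_equalityI)

lemma inst_closed:
  assumes "closed_str D"
  shows "inst \<sigma> D = D"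
proof -
  have "\<not> open_asm D p" for p using assms by (auto simp: closed_str_def open_asm_def)
  then show ?thesis
    by (auto simp: inst_def graft_empty prod_eq_iff fun_eq_iff find_None_iff[THEN iffD2])
qed

text \<open>The conditions on reductions constrain the behaviour under instantiation, and instantiation
  does nothing to closed structures.\<close>

lemma reduction_singleton:
  assumes "I \<in> inferences" "closed_str (assoc_str I)"
    "arg_structure E" "closed_str E" "concl E = concl (assoc_str I)"
  shows "reduction [assoc_str I \<mapsto> E]"
proof -
  have "asms E = {}" using assms(4) by (simp add: closed_str_iff)
  then show ?thesis
    unfolding reduction_def reduction_for_def inference_rule_def
    using assms
    by (intro exI[of _ "{I}"] conjI) (auto simp: inst_closed split: if_splits)
qed

lemma sub_structure_root: "sub_structure D [] = D"
  by (auto simp: sub_structure_def prod_eq_iff fun_eq_iff split: prod.splits option.splits)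

text \<open>Nothing lies below the root, so that the only treatment to be inherited there is that of
  remaining undischarged.\<close>

lemma replaces_root:
  assumes "arg_structure E"
  shows "replaces D [] E E"
proof -
  have "snd E r = None" if "sub_at (fst E) r = None" for r
  proof (cases "snd E r")
    case (Some q)
    then have "sub_at (fst E) r \<noteq> None"
      using assms unfolding arg_structure_def case_prod_beta by blast
    then show ?thesis using that by simp
  qed simp
  moreover have "inherited D [] S \<subseteq> {None}" for S
    by (auto simp: inherited_def sub_structure_root)
  then have "inherited D [] S = {} \<or> inherited D [] S = {None}" for S
    by (simp add: subset_singleton_iff)
  ultimately show ?thesis
    by (auto simp: replaces_def graft_root split: option.splits)
qed

lemma reduces_closed_join:
  assumes "\<forall>D \<in> set Ds. arg_structure D \<and> closed_str D"
    and "arg_structure E" "closed_str E" "concl E = A"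
    and "{\<phi>. reduction \<phi>} \<subseteq> J"
  shows "reduces J (join A Ds) E"
proof -
  let ?I = "(Ds, A, snd (join A Ds))"
  have I: "?I \<in> inferences" "assoc_str ?I = join A Ds"
    using join_inference assms(1) by blast+
  then have "reduction [join A Ds \<mapsto> E]"
    using reduction_singleton[of ?I E] assms by (simp add: closed_str_join)
  then have "reduces1 J (join A Ds) E"
    unfolding reduces1_def using assms
    by (intro bexI[of _ "[]"] bexI[of _ "[join A Ds \<mapsto> E]"] exI[of _ E])
      (auto simp: sub_structure_root replaces_root nodes_def)
  then show ?thesis by (simp add: reduces_def)
qed

section \<open>Validity of closed structures\<close>

text \<open>The defining equation of validity matches its own right-hand side and makes rewriting diverge;
  the three clauses below replace it.\<close>

declare valid_on.simps [simp del]

lemma not_atomic [simp]: "\<not> atomic (And A C)" "\<not> atomic (Or A C)" "\<not> atomic (Imp A C)"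
  by (simp_all add: atomic_def)

lemma valid_on_argument: "valid_on B D J \<Longrightarrow> argument D J"
  by (subst (asm) valid_on.simps) simp

lemma valid_on_closed_atomic:
  assumes "closed_str D" "concl D = Atom a"
  shows "valid_on B D J \<longleftrightarrow> argument D J \<and> (\<exists>D'. reduces J D D' \<and> fst D' \<in> DER B)"
  by (subst valid_on.simps) (simp add: assms atomic_def)

lemma valid_on_closed_compound:
  assumes "closed_str D" "\<not> atomic (concl D)"
  shows "valid_on B D J \<longleftrightarrow> argument D J \<and>
    (\<exists>D'. reduces J D D' \<and> canonical D' \<and> (\<forall>E \<in> immediate_subs D'. valid_on B E J))"
  by (subst valid_on.simps) (simp add: assms)

lemma valid_on_open:
  assumes "\<not> closed_str D"
  shows "valid_on B D J \<longleftrightarrow> argument D J \<and>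
    (\<forall>\<sigma> J'. J \<subseteq> J' \<and> (\<forall>\<phi> \<in> J'. reduction \<phi>) \<and> closed_substitution_for \<sigma> D \<longrightarrow>
      (\<forall>A \<in> asms D. valid_on B (\<sigma> A) J') \<longrightarrow> valid_on B (inst \<sigma> D) J')"
  by (subst valid_on.simps) (simp add: assms)

text \<open>Validity of a closed argument asks only for some reduct of the right shape, and a reduct of a
  reduct is a reduct.\<close>

lemma valid_on_expansion:
  assumes "argument D J" "closed_str D" "reduces J D E" "valid_on B E J"
  shows "valid_on B D J"
proof -
  have red: "\<And>\<phi>. \<phi> \<in> J \<Longrightarrow> reduction \<phi>" using assms(1) by (simp add: argument_def)
  have E: "closed_str E" "concl E = concl D"
    using reduces_props[OF red assms(3)] assms(2) by (auto simp: closed_str_iff)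
  have trans: "reduces J D D'" if "reduces J E D'" for D'
    using assms(3) that by (auto simp: reduces_def)
  show ?thesis
  proof (cases "atomic (concl D)")
    case True
    then obtain a where a: "concl D = Atom a" by (auto simp: atomic_def)
    then have "concl E = Atom a" using E by simp
    then show ?thesis
      using assms(1,4) trans unfolding valid_on_closed_atomic[OF assms(2) a]
        valid_on_closed_atomic[OF E(1) \<open>concl E = Atom a\<close>] by blast
  next
    case False
    then have "\<not> atomic (concl E)" using E by simp
    with False show ?thesis
      using assms(1,4) trans unfolding valid_on_closed_compound[OF assms(2) False]
        valid_on_closed_compound[OF E(1) \<open>\<not> atomic (concl E)\<close>] by blast
  qed
qed

lemma valid_on_canonical:
  assumes "argument D J" "closed_str D" "\<not> atomic (concl D)" "canonical D"
    "\<And>E. E \<in> immediate_subs D \<Longrightarrow> valid_on B E J"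
  shows "valid_on B D J"
proof -
  have "reduces J D D" by (simp add: reduces_def)
  then show ?thesis unfolding valid_on_closed_compound[OF assms(2,3)] using assms by blast
qed

text \<open>In a closed structure, an assumption that becomes open when an immediate sub-structure is cut
  out must have been discharged strictly below the cut, and only the root is there. This is why the
  premises of a canonical closed structure are closed, except for the antecedent of an implication.\<close>

lemma asms_immediate_sub_discharged:
  assumes "arg_structure D" "closed_str D" "[i] \<in> nodes (fst D)" "A \<in> asms (sub_structure D [i])"
  obtains p where "snd D p = Some []" "sub_at (fst D) p = Some (Asm A)"
proof -
  obtain U where U: "sub_at (fst D) [i] = Some U" using assms(3) unfolding nodes_def by blast
  obtain r where r: "sub_at U r = Some (Asm A)" "snd (sub_structure D [i]) r = None"
    using assms(4) U unfolding asms_iff fst_sub_structure by auto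
  have at: "sub_at (fst D) ([i] @ r) = Some (Asm A)"
    using r(1) U unfolding sub_at_append by simp
  then obtain q where q: "snd D ([i] @ r) = Some q"
    using assms(2) unfolding closed_str_def is_asm_def by blast
  then have "\<not> prefix [i] q" using r(2) by (auto simp: snd_sub_structure_None)
  moreover have "strict_prefix q ([i] @ r)"
    using assms(1) q by (cases D) (auto simp: arg_structure_def)
  ultimately have "q = []" by (cases q) auto
  then show ?thesis using that at q by blast
qed

lemma assoc_str_immediate_sub:
  assumes "(Ds, C, \<delta>) \<in> inferences" "E \<in> set Ds"
  shows "E \<in> immediate_subs (assoc_str (Ds, C, \<delta>))"
proof -
  obtain i where "i < length Ds" "E = Ds ! i" using assms(2) by (auto simp: in_set_conv_nth)
  then show ?thesis using assms(1)
    by (auto simp: inferences_def immediate_subs_def nodes_def assoc_str_def intro!: exI[of _ i])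
qed

lemma asms_premise_discharged:
  assumes "(Ds, C, \<delta>) \<in> inferences" "closed_str (assoc_str (Ds, C, \<delta>))" "E \<in> set Ds" "A \<in> asms E"
  obtains p where "\<delta> p = Some []" "sub_at (fst (assoc_str (Ds, C, \<delta>))) p = Some (Asm A)"
proof -
  have "arg_structure (assoc_str (Ds, C, \<delta>))" using assms(1) by (simp add: inferences_def)
  moreover obtain i where "[i] \<in> nodes (fst (assoc_str (Ds, C, \<delta>)))"
    "E = sub_structure (assoc_str (Ds, C, \<delta>)) [i]"
    using assoc_str_immediate_sub[OF assms(1,3)] by (auto simp: immediate_subs_def)
  ultimately show ?thesis
    using asms_immediate_sub_discharged[of "assoc_str (Ds, C, \<delta>)" i A] assms(2,4) that
    by (auto simp: assoc_str_def)
qed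

lemma canonical_AndE:
  assumes "canonical D" "closed_str D" "concl D = And A C"
  obtains E F where "E \<in> immediate_subs D" "F \<in> immediate_subs D" "closed_str E" "closed_str F"
    "concl E = A" "concl F = C"
proof -
  obtain Ds \<delta> where I: "(Ds, And A C, \<delta>) \<in> inferences" "map concl Ds = [A, C]"
    "\<forall>p. \<delta> p \<noteq> Some []" "D = assoc_str (Ds, And A C, \<delta>)"
    using assms(1,3) unfolding canonical_def conj_intro_def disj_intro_def imp_intro_def
    by (auto simp: concl_def assoc_str_def)
  have "E \<in> immediate_subs D \<and> closed_str E" if "E \<in> set Ds" for E
    using assoc_str_immediate_sub[OF I(1) that] asms_premise_discharged[OF I(1) _ that] I(3,4) assms(2)
    by (auto simp: closed_str_iff[of E])
  moreover obtain E F where "Ds = [E, F]" "concl E = A" "concl F = C"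
    using I(2) by auto
  ultimately show ?thesis using that by (metis list.set_intros)
qed

lemma canonical_OrE:
  assumes "canonical D" "closed_str D" "concl D = Or A C"
  obtains E where "E \<in> immediate_subs D" "closed_str E" "concl E = A \<or> concl E = C"
proof -
  obtain Ds \<delta> where I: "(Ds, Or A C, \<delta>) \<in> inferences" "map concl Ds = [A] \<or> map concl Ds = [C]"
    "\<forall>p. \<delta> p \<noteq> Some []" "D = assoc_str (Ds, Or A C, \<delta>)"
    using assms(1,3) unfolding canonical_def conj_intro_def disj_intro_def imp_intro_def
    by (auto simp: concl_def assoc_str_def)
  have "E \<in> immediate_subs D \<and> closed_str E" if "E \<in> set Ds" for E
    using assoc_str_immediate_sub[OF I(1) that] asms_premise_discharged[OF I(1) _ that] I(3,4) assms(2)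
    by (auto simp: closed_str_iff[of E])
  moreover obtain E where "Ds = [E]" "concl E = A \<or> concl E = C"
    using I(2) by auto
  ultimately show ?thesis using that by (metis list.set_intros)
qed

lemma canonical_ImpE:
  assumes "canonical D" "closed_str D" "concl D = Imp A C"
  obtains E where "E \<in> immediate_subs D" "asms E \<subseteq> {A}" "concl E = C"
proof -
  obtain Ds \<delta> where I: "(Ds, Imp A C, \<delta>) \<in> inferences" "map concl Ds = [C]"
    "\<forall>p. \<delta> p = Some [] \<longrightarrow> sub_at (fst (assoc_str (Ds, Imp A C, \<delta>))) p = Some (Asm A)"
    "D = assoc_str (Ds, Imp A C, \<delta>)"
    using assms(1,3) unfolding canonical_def conj_intro_def disj_intro_def imp_intro_def
    by (auto simp: concl_def assoc_str_def)
  obtain E where E: "Ds = [E]" "concl E = C" using I(2) by auto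
  have "E \<in> immediate_subs D" using assoc_str_immediate_sub[OF I(1)] E I(4) by auto
  moreover have "asms E \<subseteq> {A}"
  proof
    fix A' assume "A' \<in> asms E"
    then obtain p where "\<delta> p = Some []" "sub_at (fst D) p = Some (Asm A')"
      using asms_premise_discharged[OF I(1), of E A'] assms(2) E I(4) by auto
    then show "A' \<in> {A}" using I(3,4) by auto
  qed
  ultimately show ?thesis using that E by blast
qed

section \<open>Closed valid arguments and satisfaction\<close>

text \<open>Derivations over a base consist of rule applications only; so they are closed as structures.\<close>

lemma deriv_no_asm: "deriv S T \<Longrightarrow> \<not> is_asm T p"
proof (induction arbitrary: p rule: deriv.induct)
  case (1 ps A S Ts)
  show ?case
  proof (cases p)
    case Nil
    then show ?thesis by (simp add: is_asm_def)
  next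
    case (Cons i r)
    then show ?thesis using 1(2) by (auto simp: is_asm_def list_all2_conv_all_nth)
  qed
qed

text \<open>One structure has to serve every set of reductions, because it is substituted into arguments
  that come with reductions of their own, and because the two premises of a conjunction have to
  share theirs.\<close>

definition closed_proof :: "arule set \<Rightarrow> fm \<Rightarrow> argstr \<Rightarrow> bool" where
  "closed_proof B A D \<longleftrightarrow> arg_structure D \<and> closed_str D \<and> concl D = A \<and>
    (\<forall>J. (\<forall>\<phi> \<in> J. reduction \<phi>) \<longrightarrow> valid_on B D J)"

lemma closed_proof_str:
  "closed_proof B A D \<Longrightarrow> arg_structure D \<and> closed_str D \<and> concl D = A"
  by (simp add: closed_proof_def)

lemma closed_proof_canonical:
  assumes "arg_structure D" "closed_str D" "concl D = A" "\<not> atomic A" "canonical D"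
    and "\<And>E J. \<lbrakk>E \<in> immediate_subs D; \<forall>\<phi> \<in> J. reduction \<phi>\<rbrakk> \<Longrightarrow> valid_on B E J"
  shows "closed_proof B A D"
  unfolding closed_proof_def
  using assms by (simp add: valid_on_canonical argument_def)

text \<open>A derivation over \<open>B\<close>, with nothing discharged, is itself a closed proof of its conclusion.\<close>

lemma closed_proof_Atom:
  assumes "derivable B a"
  shows "\<exists>D. closed_proof B (Atom a) D"
proof -
  obtain T where T: "deriv B T" "label T = Atom a"
    using assms by (auto simp: derivable_def DER_def)
  let ?D = "(T, Map.empty) :: argstr"
  have D: "closed_str ?D" "concl ?D = Atom a" "arg_structure ?D"
    using T deriv_no_asm by (auto simp: closed_str_def concl_def arg_structure_def)
  have "reduces J ?D ?D" for J by (simp add: reduces_def)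
  moreover have "fst ?D \<in> DER B" using T(1) by (simp add: DER_def)
  ultimately have "closed_proof B (Atom a) ?D"
    using D unfolding closed_proof_def valid_on_closed_atomic[OF D(1,2)] argument_def by blast
  then show ?thesis by blast
qed

lemma closed_proof_And:
  assumes "closed_proof B A D" "closed_proof B C E"
  shows "closed_proof B (And A C) (join (And A C) [D, E])"
proof (rule closed_proof_canonical)
  show "canonical (join (And A C) [D, E])"
    using assms[THEN closed_proof_str] canonical_join_And[of D E] by simp
  fix F J assume "F \<in> immediate_subs (join (And A C) [D, E])" "\<forall>\<phi> \<in> J. reduction \<phi>"
  then show "valid_on B F J" using assms by (auto simp only: immediate_subs_join closed_proof_def list.set)
next
  show "arg_structure (join (And A C) [D, E])" "closed_str (join (And A C) [D, E])"
    using assms[THEN closed_proof_str] by (simp_all add: arg_structure_join closed_str_join)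
qed simp_all

lemma closed_proof_Or:
  assumes "closed_proof B F D" "F = A \<or> F = C"
  shows "closed_proof B (Or A C) (join (Or A C) [D])"
proof (rule closed_proof_canonical)
  show "canonical (join (Or A C) [D])"
    using closed_proof_str[OF assms(1)] assms(2) canonical_join_Or[of D A C] by simp
  fix F J assume "F \<in> immediate_subs (join (Or A C) [D])" "\<forall>\<phi> \<in> J. reduction \<phi>"
  then show "valid_on B F J" using assms(1) by (simp add: immediate_subs_join closed_proof_def)
next
  show "arg_structure (join (Or A C) [D])" "closed_str (join (Or A C) [D])"
    using closed_proof_str[OF assms(1)] by (simp_all add: arg_structure_join closed_str_join)
qed simp_all

text \<open>The introduction discharges nothing: a true consequent makes the implication true.\<close>

lemma closed_proof_Imp:
  assumes "closed_proof B C D"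
  shows "closed_proof B (Imp A C) (join (Imp A C) [D])"
proof (rule closed_proof_canonical)
  show "canonical (join (Imp A C) [D])"
    using assms[THEN closed_proof_str] canonical_join_Imp[of D A] by simp
  fix F J assume "F \<in> immediate_subs (join (Imp A C) [D])" "\<forall>\<phi> \<in> J. reduction \<phi>"
  then show "valid_on B F J" using assms(1) by (simp add: immediate_subs_join closed_proof_def)
next
  show "arg_structure (join (Imp A C) [D])" "closed_str (join (Imp A C) [D])"
    using closed_proof_str[OF assms(1)] by (simp_all add: arg_structure_join closed_str_join)
qed (simp_all add: atomic_def)

text \<open>The unjustified inference from \<open>A\<close> to \<open>C\<close>, followed by an introduction of \<open>A \<rightarrow> C\<close> that
  discharges \<open>A\<close>. It is meant for formulas \<open>A\<close> without closed valid arguments.\<close>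

definition imp_of_false :: "fm \<Rightarrow> fm \<Rightarrow> argstr" where
  "imp_of_false A C = (Inf (Imp A C) [Inf C [Asm A]], [[0, 0] \<mapsto> []])"

lemma sub_at_single_inference:
  "sub_at (Inf C [Asm A]) p = Some (Asm A') \<longleftrightarrow> p = [0] \<and> A' = A"
  by (cases p; cases "tl p") auto

lemma imp_of_false:
  shows "canonical (imp_of_false A C)" "closed_str (imp_of_false A C)"
    "arg_structure (imp_of_false A C)" "concl (imp_of_false A C) = Imp A C"
    "immediate_subs (imp_of_false A C) = {(Inf C [Asm A], Map.empty)}"
proof -
  let ?E = "(Inf C [Asm A], Map.empty) :: argstr"
  have asm: "sub_at (Inf (Imp A C) [Inf C [Asm A]]) p = Some (Asm A') \<longleftrightarrow> p = [0, 0] \<and> A' = A" for p A'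
    by (cases p) (auto simp: sub_at_single_inference)
  show cl: "closed_str (imp_of_false A C)"
    by (auto simp: closed_str_def imp_of_false_def is_asm_def asm)
  show arg: "arg_structure (imp_of_false A C)"
    by (auto simp: arg_structure_def imp_of_false_def)
  show "concl (imp_of_false A C) = Imp A C"
    by (simp add: imp_of_false_def concl_def)
  have sub: "sub_structure (imp_of_false A C) [0] = ?E"
    by (auto simp: imp_of_false_def sub_structure_def fun_eq_iff)
  have "[i] \<in> nodes (fst (imp_of_false A C)) \<longleftrightarrow> i = 0" for i
    by (simp add: nodes_def imp_of_false_def dom_def)
  then show "immediate_subs (imp_of_false A C) = {?E}"
    using sub by (auto simp: immediate_subs_def)
  have eq: "assoc_str ([?E], Imp A C, [[0, 0] \<mapsto> []]) = imp_of_false A C"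
    by (simp add: assoc_str_def imp_of_false_def)
  then have "([?E], Imp A C, [[0, 0] \<mapsto> []]) \<in> imp_intro"
    using arg sub by (auto simp: imp_intro_def inferences_def arg_structure_def[of ?E] concl_def imp_of_false_def)
  then show "canonical (imp_of_false A C)"
    unfolding canonical_def eq[symmetric] by blast
qed

text \<open>The open premise from \<open>A\<close> to \<open>C\<close> is vacuously valid: there is nothing to substitute for \<open>A\<close>.\<close>

lemma closed_proof_Imp_of_false:
  assumes "\<And>D J. \<lbrakk>closed_str D; concl D = A\<rbrakk> \<Longrightarrow> \<not> valid_on B D J"
  shows "closed_proof B (Imp A C) (imp_of_false A C)"
proof (rule closed_proof_canonical)
  let ?E = "(Inf C [Asm A], Map.empty) :: argstr"
  have E: "asms ?E = {A}" "arg_structure ?E"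
    by (auto simp: asms_iff sub_at_single_inference arg_structure_def)
  fix F J assume F: "F \<in> immediate_subs (imp_of_false A C)" "\<forall>\<phi> \<in> J. reduction \<phi>"
  have "\<not> valid_on B (\<sigma> A) J'" if "closed_substitution_for \<sigma> ?E" for \<sigma> J'
    using that assms E(1) by (simp add: closed_substitution_for_def substitution_for_def)
  moreover have "\<not> closed_str ?E" using E(1) by (simp add: closed_str_iff)
  ultimately have "valid_on B ?E J"
    using E F(2) by (simp add: valid_on_open argument_def)
  then show "valid_on B F J" using F(1) by (simp add: imp_of_false(5))
qed (simp_all add: imp_of_false)

lemma closed_valid_canonical_reduct:
  assumes "closed_str D" "valid_on B D J" "concl D = A" "\<not> atomic A"
  obtains D' where "canonical D'" "closed_str D'" "concl D' = A"
    "\<forall>E \<in> immediate_subs D'. valid_on B E J"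
proof -
  obtain D' where D': "reduces J D D'" "canonical D'" "\<forall>E \<in> immediate_subs D'. valid_on B E J"
    and J: "argument D J"
    using assms(2) assms(4) unfolding assms(3)[symmetric] valid_on_closed_compound[OF assms(1) assms(4)[folded assms(3)]] by blast
  have "closed_str D'" "concl D' = A"
    using reduces_props[of J D D'] D'(1) J assms(1,3) by (auto simp: argument_def closed_str_iff)
  then show ?thesis using that D' by blast
qed

text \<open>Both directions are proved in one induction. At an implication, soundness substitutes the
  closed proof of the antecedent given by completeness, and completeness uses the soundness of the
  antecedent to see that a false antecedent has no closed valid argument.\<close>

lemma closed_valid_adequate:
  "(\<forall>D J. closed_str D \<and> concl D = A \<and> valid_on B D J \<longrightarrow> sat B A) \<and>
    (sat B A \<longrightarrow> (\<exists>D. closed_proof B A D))"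
  (is "?sound A \<and> (sat B A \<longrightarrow> ?complete A)")
proof (induction A)
  case (Atom a)
  have "?sound (Atom a)"
  proof (intro allI impI, elim conjE)
    fix D J assume D: "closed_str D" "concl D = Atom a" "valid_on B D J"
    then obtain D' where D': "reduces J D D'" "fst D' \<in> DER B" "argument D J"
      unfolding valid_on_closed_atomic[OF D(1,2)] by blast
    then have "concl D' = Atom a"
      using reduces_props[of J D D'] D by (simp add: argument_def)
    then show "sat B (Atom a)" using D'(2) by (auto simp: derivable_def concl_def)
  qed
  moreover have "?complete (Atom a)" if "sat B (Atom a)"
    using closed_proof_Atom that unfolding sat.simps .
  ultimately show ?case by blast
next
  case (And A C)
  have "?sound (And A C)"
  proof (intro allI impI, elim conjE)
    fix D J assume D: "closed_str D" "concl D = And A C" "valid_on B D J"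
    obtain D' where D': "canonical D'" "closed_str D'" "concl D' = And A C"
      "\<forall>E \<in> immediate_subs D'. valid_on B E J"
      by (rule closed_valid_canonical_reduct[OF D(1,3,2) not_atomic(1)])
    obtain E F where EF: "E \<in> immediate_subs D'" "F \<in> immediate_subs D'"
      "closed_str E" "closed_str F" "concl E = A" "concl F = C"
      by (rule canonical_AndE[OF D'(1-3)])
    then have "valid_on B E J" "valid_on B F J" using D'(4) by blast+
    then have "sat B A" "sat B C" using EF(3-6) And.IH by blast+
    then show "sat B (And A C)" by simp
  qed
  moreover have "?complete (And A C)" if "sat B (And A C)"
    using that And.IH closed_proof_And unfolding sat.simps by blast
  ultimately show ?case by blast
next
  case (Or A C)
  have "?sound (Or A C)"
  proof (intro allI impI, elim conjE)
    fix D J assume D: "closed_str D" "concl D = Or A C" "valid_on B D J"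
    obtain D' where D': "canonical D'" "closed_str D'" "concl D' = Or A C"
      "\<forall>E \<in> immediate_subs D'. valid_on B E J"
      by (rule closed_valid_canonical_reduct[OF D(1,3,2) not_atomic(2)])
    obtain E where E: "E \<in> immediate_subs D'" "closed_str E" "concl E = A \<or> concl E = C"
      by (rule canonical_OrE[OF D'(1-3)])
    then have "valid_on B E J" using D'(4) by blast
    then have "sat B A \<or> sat B C" using E(2,3) Or.IH by blast
    then show "sat B (Or A C)" by simp
  qed
  moreover have "?complete (Or A C)" if "sat B (Or A C)"
    using that Or.IH closed_proof_Or unfolding sat.simps by blast
  ultimately show ?case by blast
next
  case (Imp A C)
  have "?sound (Imp A C)"
  proof (intro allI impI, elim conjE)
    fix D J assume D: "closed_str D" "concl D = Imp A C" "valid_on B D J"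
    obtain D' where D': "canonical D'" "closed_str D'" "concl D' = Imp A C"
      "\<forall>E \<in> immediate_subs D'. valid_on B E J"
      by (rule closed_valid_canonical_reduct[OF D(1,3,2) not_atomic(3)])
    obtain E where E': "E \<in> immediate_subs D'" and E: "asms E \<subseteq> {A}" "concl E = C"
      by (rule canonical_ImpE[OF D'(1-3)])
    have val: "valid_on B E J" using D'(4) E' by blast
    have "sat B C" if satA: "sat B A"
    proof (cases "closed_str E")
      case True
      then show ?thesis using Imp.IH(2) E(2) val by blast
    next
      case False
      obtain P where P: "closed_proof B A P" using Imp.IH(1) satA by blast
      have \<sigma>: "closed_substitution_for (\<lambda>_. P) E"
        using closed_proof_str[OF P] E(1) by (auto simp: closed_substitution_for_def substitution_for_def)
      have J: "\<forall>\<phi> \<in> J. reduction \<phi>"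
        using valid_on_argument[OF val] by (simp add: argument_def)
      then have "valid_on B P J" using P by (simp add: closed_proof_def)
      then have "valid_on B (inst (\<lambda>_. P) E) J"
        using val \<sigma> J E(1) unfolding valid_on_open[OF False] by blast
      then show ?thesis using Imp.IH(2) inst_props[OF \<sigma>] E(2) by metis
    qed
    then show "sat B (Imp A C)" by simp
  qed
  moreover have "?complete (Imp A C)" if sat: "sat B (Imp A C)"
  proof (cases "sat B A")
    case True
    then have "sat B C" using sat by simp
    then show ?thesis using Imp.IH(2) closed_proof_Imp by blast
  next
    case False
    then show ?thesis using Imp.IH(1) closed_proof_Imp_of_false[of A B C] by blast
  qed
  ultimately show ?case by blast
qed

lemma closed_valid_sat:
  assumes "closed_str D" "valid_on B D J"
  shows "sat B (concl D)"
  using closed_valid_adequate[of "concl D" B] assms by blast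

lemma sat_closed_proof: "sat B A \<Longrightarrow> \<exists>D. closed_proof B A D"
  using closed_valid_adequate[of A B] by blast

section \<open>The two consequence relations\<close>

definition single_inference :: "fm list \<Rightarrow> fm \<Rightarrow> argstr" where
  "single_inference \<Gamma> A = join A (map (\<lambda>C. (Asm C, Map.empty)) \<Gamma>)"

lemma arg_structure_single_inference: "arg_structure (single_inference \<Gamma> A)"
proof -
  have "arg_structure (Asm C, Map.empty)" for C by (simp add: arg_structure_def)
  then show ?thesis by (simp add: single_inference_def arg_structure_join)
qed

lemma open_asm_single_inference:
  "open_asm (single_inference \<Gamma> A) p \<longleftrightarrow> (\<exists>i < length \<Gamma>. p = [i])"
proof (cases p)
  case Nil
  then show ?thesis by (simp add: open_asm_def single_inference_def is_asm_join)
next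
  case (Cons i r)
  then show ?thesis
    by (cases r) (auto simp: open_asm_def single_inference_def is_asm_join_Cons, auto simp: join_def is_asm_def)
qed

lemma label_at_single_inference:
  "i < length \<Gamma> \<Longrightarrow> label_at (fst (single_inference \<Gamma> A)) [i] = \<Gamma> ! i"
  by (simp add: label_at_def single_inference_def join_def)

lemma asms_single_inference: "asms (single_inference \<Gamma> A) = set \<Gamma>"
  by (auto simp: asms_def open_asm_single_inference in_set_conv_nth label_at_single_inference)
    (metis label_at_single_inference)

text \<open>The open assumptions are exactly the premises, and so an instance arises by putting the
  substituted structures in their places.\<close>

lemma inst_single_inference:
  "inst \<sigma> (single_inference \<Gamma> A) = join A (map \<sigma> \<Gamma>)"
proof -
  let ?D = "single_inference \<Gamma> A"
  have "snd (inst \<sigma> ?D) q = snd (join A (map \<sigma> \<Gamma>)) q" for q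
  proof (cases q)
    case Nil
    then show ?thesis
      by (simp add: inst_def open_asm_single_inference) (simp add: single_inference_def join_def)
  next
    case (Cons i r)
    show ?thesis
    proof (cases "i < length \<Gamma>")
      case True
      then have find: "find (open_asm ?D) (prefixes q) = Some [i]"
        unfolding Cons by (cases r) (auto simp: open_asm_single_inference)
      have "(@) [i] = (#) i" by (simp add: fun_eq_iff)
      then show ?thesis
        using True unfolding inst_def snd_conv find
        by (simp add: label_at_single_inference Cons) (simp add: join_def)
    next
      case False
      then have "find (open_asm ?D) (prefixes q) = None"
        by (auto simp: find_None_iff open_asm_single_inference Cons)
      then show ?thesis
        using False by (simp add: inst_def Cons) (simp add: single_inference_def join_def)
    qed
  qed
  moreover have "fst (inst \<sigma> ?D) = fst (join A (map \<sigma> \<Gamma>))"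
  proof -
    have "fst (inst \<sigma> ?D) =
      graft (\<lambda>p. if open_asm ?D p then Some (fst (\<sigma> (label_at (fst ?D) p))) else None)
        (Inf A (map Asm \<Gamma>))"
      by (simp add: inst_def single_inference_def join_def comp_def)
    then show ?thesis
      by (auto simp: open_asm_single_inference label_at_single_inference join_def
          intro!: nth_equalityI)
  qed
  ultimately show ?thesis by (auto simp: prod_eq_iff fun_eq_iff)
qed

text \<open>Closed proofs of the assumptions turn an open valid argument into a closed one, for which
  validity implies satisfaction.\<close>

lemma sat_if_valid_on:
  assumes "valid_on B D J" "\<forall>C \<in> asms D. sat B C"
  shows "sat B (concl D)"
proof (cases "closed_str D")
  case True
  then show ?thesis using assms closed_valid_sat by blast
next
  case False
  obtain \<sigma> where \<sigma>: "\<forall>C \<in> asms D. closed_proof B C (\<sigma> C)"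
    using assms(2) sat_closed_proof by metis
  then have sub: "closed_substitution_for \<sigma> D"
    by (simp add: closed_substitution_for_def substitution_for_def closed_proof_def)
  moreover have "\<forall>\<phi> \<in> J. reduction \<phi>"
    using valid_on_argument[OF assms(1)] by (simp add: argument_def)
  ultimately have "valid_on B (inst \<sigma> D) J"
    using assms(1) \<sigma> unfolding valid_on_open[OF False] closed_proof_def by blast
  then show ?thesis using closed_valid_sat inst_props[OF sub] by metis
qed

text \<open>With all reductions at hand, a closed inference reduces in one step to a closed proof of its
  conclusion, however bad its premises may be.\<close>

lemma valid_on_join_of_sat:
  assumes "sat B A" "\<forall>D \<in> set Ds. arg_structure D \<and> closed_str D" "J = {\<phi>. reduction \<phi>}"
  shows "valid_on B (join A Ds) J"
proof -
  obtain E where E: "arg_structure E" "closed_str E" "concl E = A" "valid_on B E J"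
    using sat_closed_proof[OF assms(1)] assms(3) by (auto simp: closed_proof_def)
  show ?thesis
  proof (rule valid_on_expansion)
    show "reduces J (join A Ds) E" using E assms by (intro reduces_closed_join) auto
    show "argument (join A Ds) J" using assms by (simp add: argument_def arg_structure_join)
    show "closed_str (join A Ds)" using assms by (simp add: closed_str_join)
  qed fact
qed

text \<open>Valid substituents show that \<open>B\<close> satisfies \<open>\<Gamma>\<close>, hence \<open>A\<close>; what they look like is forgotten
  when the instance is replaced by a closed proof of \<open>A\<close>.\<close>

lemma valid_on_single_inference:
  assumes "(\<forall>C \<in> set \<Gamma>. sat B C) \<longrightarrow> sat B A" "J = {\<phi>. reduction \<phi>}"
  shows "valid_on B (single_inference \<Gamma> A) J"
proof (cases "\<Gamma> = []")
  \<comment> \<open>Without premises the inference is closed, and the clause for open arguments does not apply.\<close>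
  case True
  then show ?thesis
    using assms valid_on_join_of_sat[of B A "[]" J] by (simp add: single_inference_def)
next
  case False
  have "argument (single_inference \<Gamma> A) J"
    using assms(2) by (simp add: argument_def arg_structure_single_inference)
  moreover have "valid_on B (inst \<sigma> (single_inference \<Gamma> A)) J'"
    if "J \<subseteq> J'" "\<forall>\<phi> \<in> J'. reduction \<phi>" "closed_substitution_for \<sigma> (single_inference \<Gamma> A)"
      "\<forall>C \<in> set \<Gamma>. valid_on B (\<sigma> C) J'" for \<sigma> J'
  proof -
    \<comment> \<open>The reductions needed depend on \<open>\<sigma>\<close>, but all of them are in \<open>J\<close> already.\<close>
    have "J' = {\<phi>. reduction \<phi>}" using that assms(2) by auto
    moreover have \<sigma>: "\<forall>C \<in> set \<Gamma>. arg_structure (\<sigma> C) \<and> closed_str (\<sigma> C) \<and> concl (\<sigma> C) = C"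
      using that(3) by (simp add: closed_substitution_for_def substitution_for_def asms_single_inference)
    moreover have "sat B A" using \<sigma> closed_valid_sat that(4) assms(1) by metis
    ultimately show ?thesis by (simp add: inst_single_inference valid_on_join_of_sat)
  qed
  moreover have "\<not> closed_str (single_inference \<Gamma> A)"
    using False by (simp add: closed_str_iff asms_single_inference)
  ultimately show ?thesis by (simp add: valid_on_open asms_single_inference)
qed

theorem theorem2:
  fixes \<Gamma> :: "fm set" and A :: fm
  assumes "finite \<Gamma>"
  shows "\<Gamma> \<Turnstile> A \<longleftrightarrow> \<Gamma> \<Turnstile>\<^sup>\<alpha> A"
proof
  assume conseq: "\<Gamma> \<Turnstile> A"
  obtain \<Gamma>s where \<Gamma>s: "set \<Gamma>s = \<Gamma>" using assms finite_list by blast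
  let ?D = "single_inference \<Gamma>s A" and ?J = "{\<phi>. reduction \<phi>}"
  have "valid ?D ?J"
    unfolding valid_def
  proof (intro allI impI)
    fix B assume "atomic_base B"
    then have "(\<forall>C \<in> set \<Gamma>s. sat B C) \<longrightarrow> sat B A"
      using conseq \<Gamma>s by (auto simp: base_conseq_def base_conseq_on_def split: if_splits)
    then show "valid_on B ?D ?J" by (simp add: valid_on_single_inference)
  qed
  moreover have "argument ?D ?J"
    by (simp add: argument_def arg_structure_single_inference)
  moreover have "asms ?D = \<Gamma>" "concl ?D = A"
    using \<Gamma>s by (simp_all add: asms_single_inference) (simp add: single_inference_def)
  ultimately show "\<Gamma> \<Turnstile>\<^sup>\<alpha> A" unfolding reducibility_conseq_def by blast
next
  assume "\<Gamma> \<Turnstile>\<^sup>\<alpha> A"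
  then obtain D J where D: "asms D = \<Gamma>" "concl D = A" "valid D J"
    unfolding reducibility_conseq_def by blast
  show "\<Gamma> \<Turnstile> A"
    unfolding base_conseq_def
  proof (intro allI impI)
    fix B assume "atomic_base B"
    then have "valid_on B D J" using D(3) by (simp add: valid_def)
    then have "(\<forall>C \<in> \<Gamma>. sat B C) \<longrightarrow> sat B A"
      using sat_if_valid_on[of B D J] D(1,2) by blast
    then show "base_conseq_on B \<Gamma> A" by (simp add: base_conseq_on_def)
  qed
qed

end
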